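(* Let $\lambda\in\mathbb{R}$, $\alpha>0$, $k\in\mathbb{N}=\{1,2,3,\dots\}$, let $X_{1,\lambda},X_{2,\lambda},\dots,X_{k,\lambda}$ be independent degenerate zero-truncated Poisson random variables, each with parameter $\alpha$, and let $X_\lambda=\sum_{i=1}^kX_{i,\lambda}$. Then, for every nonnegative integer $n$, $$P_\lambda[X_\lambda=n]=\begin{cases}\dfrac{k!}{(e_\lambda(\alpha)-1)^k}\,\dfrac{\alpha^n}{n!}\,S_{2,\lambda}(n,k),&\text{if } n\ge k,\\[2mm]0,&\text{otherwise,}\end{cases}$$ where $S_{2,\lambda}(n,k)$ are the degenerate Stirling numbers of the second kind and $P_\lambda[X_\lambda=n]$ is the probability that $X_\lambda=n$.
   Context: For real $x,\lambda$ the $\lambda$-falling factorials are $(x)_{0,\lambda}=1$ and $(x)_{n,\lambda}=x(x-\lambda)(x-2\lambda)\cdots(x-(n-1)\lambda)$ for $n\ge1$. The degenerate exponential is $e_\lambda^x(t)=(1+\lambda t)^{x/\lambda}=\sum_{n=0}^\infty (x)_{n,\lambda}\frac{t^n}{n!}$ (for $\lambda=0$ it is understood as the limit $e^{xt}$), with $e_\lambda(t)=e_\lambda^1(t)$. The degenerate Stirling numbers of the second kind $S_{2,\lambda}(n,k)$ are defined by the generating function (power series in $t$) $$\frac{1}{k!}\big(e_\lambda(t)-1\big)^k=\sum_{n=k}^\infty S_{2,\lambda}(n,k)\frac{t^n}{n!},\qquad k\ge0.$$ A random variable $X$ taking values in $\{1,2,3,\dots\}$ is a degenerate zero-truncated Poisson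 random variable with parameter $\alpha>0$ if its probability mass function is $$P_\lambda(n)=P\{X=n\}=\frac{1}{e_\lambda(\alpha)-1}\,\frac{\alpha^n}{n!}\,(1)_{n,\lambda},\qquad n=1,2,3,\dots$$ As part of this definition, $\lambda$ and $\alpha$ are such that this formula is meaningful and is a probability mass function (the values are nonnegative, and the series $\sum_{n\ge 0}(1)_{n,\lambda}\alpha^n/n!$ converges to $e_\lambda(\alpha)$, so that the values sum to $1$). *)

theory Defs
  imports "HOL-Probability.Probability" "HOL-Computational_Algebra.Formal_Power_Series"
begin

text \<open>\<open>deg_ffact lam x n\<close> is the \<open>lam\<close>-falling factorial \<open>x (x - lam) \<dots> (x - (n-1) lam)\<close>.\<close>

definition deg_ffact :: "real \<Rightarrow> real \<Rightarrow> nat \<Rightarrow> real" where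
  "deg_ffact lam x n = (\<Prod>i<n. x - real i * lam)"

text \<open>The closed form is meant for \<open>1 + lam t > 0\<close>; outside this range \<open>powr\<close> only has a
  conventional value.\<close>

definition deg_exp :: "real \<Rightarrow> real \<Rightarrow> real \<Rightarrow> real" where
  "deg_exp lam x t = (if lam = 0 then exp (x * t) else (1 + lam * t) powr (x / lam))"

definition deg_exp_fps :: "real \<Rightarrow> real \<Rightarrow> real fps" where
  "deg_exp_fps lam x = Abs_fps (\<lambda>n. deg_ffact lam x n / fact n)"

text \<open>The formal series is the Taylor series of the closed form.\<close>

lemma deg_exp_fps_sums:
  assumes "\<bar>lam * t\<bar> < 1"
  shows "(\<lambda>n. fps_nth (deg_exp_fps lam x) n * t ^ n) sums deg_exp lam x t"
proof (cases "lam = 0")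
  case True
  have "(\<lambda>n. (x * t) ^ n /\<^sub>R fact n) sums exp (x * t)"
    by (rule exp_converges)
  then show ?thesis
    using True by (simp add: deg_exp_def deg_exp_fps_def deg_ffact_def field_simps)
next
  case False
  have "(x / lam gchoose n) * (lam * t) ^ n = fps_nth (deg_exp_fps lam x) n * t ^ n" for n
  proof -
    have "(\<Prod>i<n. x - real i * lam) = (\<Prod>i<n. (x / lam - real i) * lam)"
      using False by (intro prod.cong) (auto simp: field_simps)
    also have "\<dots> = (\<Prod>i<n. x / lam - real i) * lam ^ n"
      by (simp add: prod.distrib)
    finally show ?thesis
      by (simp add: deg_exp_fps_def deg_ffact_def gbinomial_prod_rev atLeast0LessThan
          power_mult_distrib)
  qed
  with gen_binomial_real[OF assms, of "x / lam"] False show ?thesis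
    by (simp add: deg_exp_def)
qed

text \<open>Degenerate Stirling numbers of the second kind, read off as coefficients of their
  exponential generating function in \<open>t\<close>.\<close>

definition deg_Stirling2 :: "real \<Rightarrow> nat \<Rightarrow> nat \<Rightarrow> real" where
  "deg_Stirling2 lam n k =
     fact n * fps_nth (fps_const (1 / fact k) * (deg_exp_fps lam 1 - 1) ^ k) n"

lemma deg_Stirling2_gf:
  "fps_const (1 / fact k) * (deg_exp_fps lam 1 - 1) ^ k =
     Abs_fps (\<lambda>n. deg_Stirling2 lam n k / fact n)"
  by (rule fps_ext) (simp add: deg_Stirling2_def)

lemma deg_Stirling2_eq_0: "n < k \<Longrightarrow> deg_Stirling2 lam n k = 0"
proof -
  assume "n < k"
  moreover have "fps_nth (deg_exp_fps lam 1 - 1) 0 = 0"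
    by (simp add: deg_exp_fps_def deg_ffact_def)
  ultimately show ?thesis
    by (simp add: deg_Stirling2_def startsby_zero_power_prefix)
qed

definition deg_ztp_mass :: "real \<Rightarrow> real \<Rightarrow> nat \<Rightarrow> real" where
  "deg_ztp_mass lam \<alpha> n =
     1 / (deg_exp lam 1 \<alpha> - 1) * (\<alpha> ^ n / fact n) * deg_ffact lam 1 n"

text \<open>The parameters for which \<open>deg_ztp_mass\<close> is a probability mass function on
  \<open>{1, 2, \<dots>}\<close>. For \<open>lam < 0\<close> the convergence requirement forces \<open>1 + lam \<alpha> > 0\<close>, so
  \<open>deg_exp lam 1 \<alpha>\<close> is never used outside the range where the closed form is meaningful.\<close>

definition deg_ztp_admissible :: "real \<Rightarrow> real \<Rightarrow> bool" where
  "deg_ztp_admissible lam \<alpha> \<longleftrightarrow>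
     \<alpha> > 0 \<and> deg_exp lam 1 \<alpha> \<noteq> 1 \<and> (\<forall>n\<ge>1. deg_ztp_mass lam \<alpha> n \<ge> 0) \<and>
     (\<lambda>n. deg_ffact lam 1 n * \<alpha> ^ n / fact n) sums deg_exp lam 1 \<alpha>"

definition deg_zt_Poisson :: "'a measure \<Rightarrow> real \<Rightarrow> real \<Rightarrow> ('a \<Rightarrow> nat) \<Rightarrow> bool" where
  "deg_zt_Poisson M lam \<alpha> X \<longleftrightarrow>
     deg_ztp_admissible lam \<alpha> \<and>
     X \<in> measurable M (count_space UNIV) \<and>
     (\<forall>\<omega>\<in>space M. X \<omega> \<ge> 1) \<and>
     (\<forall>n\<ge>1. measure M {\<omega> \<in> space M. X \<omega> = n} = deg_ztp_mass lam \<alpha> n)"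

end

theory Submission
  imports Defs
begin

text \<open>
  Encode the law of an \<open>\<nat>\<close>-valued random variable by its probability generating series. Such
  series multiply under independent sums, because the law of a sum is the convolution of the
  laws and the Cauchy product of series is that same convolution (\<open>pgf_sum_indep\<close>).

  The generating series of one degenerate zero-truncated Poisson variable is
  \<open>(e\<^sub>\<lambda>(\<alpha>t) - 1) / (e\<^sub>\<lambda>(\<alpha>) - 1)\<close>: removing the mass at \<open>0\<close> is exactly subtracting the constant
  term \<open>1\<close> of \<open>e\<^sub>\<lambda>\<close> (\<open>pgf_deg_zt_Poisson\<close>). Its \<open>k\<close>-th power therefore contains
  \<open>(e\<^sub>\<lambda>(\<alpha>t) - 1)\<^sup>k\<close>, which is \<open>k!\<close> times the exponential generating function that defines the
  degenerate Stirling numbers, evaluated at \<open>\<alpha>t\<close>; comparing coefficients of \<open>t\<^sup>n\<close> gives the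
  formula. For \<open>n < k\<close> the Stirling number vanishes, so both cases are one identity.
\<close>

definition pgf :: "'a measure \<Rightarrow> ('a \<Rightarrow> nat) \<Rightarrow> real fps" where
  "pgf M X = Abs_fps (\<lambda>n. measure M {\<omega> \<in> space M. X \<omega> = n})"

lemma (in prob_space) pgf_add_indep:
  fixes X Y :: "'a \<Rightarrow> nat"
  assumes "indep_var (count_space UNIV) X (count_space UNIV) Y"
  shows "pgf M (\<lambda>\<omega>. X \<omega> + Y \<omega>) = pgf M X * pgf M Y"
proof (rule fps_ext)
  fix n
  have [measurable]: "X \<in> measurable M (count_space UNIV)" "Y \<in> measurable M (count_space UNIV)"
    using assms indep_var_rv1 indep_var_rv2 by blast+
  have "{\<omega> \<in> space M. X \<omega> + Y \<omega> = n} = (\<Union>j\<in>{0..n}. {\<omega> \<in> space M. X \<omega> = j \<and> Y \<omega> = n - j})"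
    by auto
  also have "prob \<dots> = (\<Sum>j=0..n. prob {\<omega> \<in> space M. X \<omega> = j \<and> Y \<omega> = n - j})"
    by (intro finite_measure_finite_Union) (auto simp: disjoint_family_on_def)
  also have "\<dots> = (\<Sum>j=0..n. prob {\<omega> \<in> space M. X \<omega> = j} * prob {\<omega> \<in> space M. Y \<omega> = n - j})"
  proof (rule sum.cong [OF refl])
    fix j
    show "prob {\<omega> \<in> space M. X \<omega> = j \<and> Y \<omega> = n - j} =
        prob {\<omega> \<in> space M. X \<omega> = j} * prob {\<omega> \<in> space M. Y \<omega> = n - j}"
      using indep_varD [OF assms, of "{j}" "{n - j}"]
      by (simp add: vimage_def Int_def conj_commute)
  qed
  finally show "fps_nth (pgf M (\<lambda>\<omega>. X \<omega> + Y \<omega>)) n = fps_nth (pgf M X * pgf M Y) n"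
    by (simp add: pgf_def fps_mult_nth)
qed

text \<open>Embedding \<open>\<nat>\<close> into \<open>\<real>\<close> reduces this to \<open>indep_vars_sum\<close>, which speaks of real random
  variables; the measurable map \<open>x \<mapsto> nat \<lfloor>x\<rfloor>\<close> undoes the embedding and preserves independence.\<close>

lemma (in prob_space) indep_var_sum_nat:
  fixes X :: "'i \<Rightarrow> 'a \<Rightarrow> nat"
  assumes "finite I" "i \<notin> I" "indep_vars (\<lambda>_. count_space UNIV) X (insert i I)"
  shows "indep_var (count_space UNIV) (X i) (count_space UNIV) (\<lambda>\<omega>. \<Sum>j\<in>I. X j \<omega>)"
proof -
  have "indep_vars (\<lambda>_. borel) (\<lambda>j \<omega>. real (X j \<omega>)) (insert i I)"
    using assms(3) by (rule indep_vars_compose2) simp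
  then have "indep_var borel (\<lambda>\<omega>. real (X i \<omega>)) borel (\<lambda>\<omega>. \<Sum>j\<in>I. real (X j \<omega>))"
    using assms(1,2) by (intro indep_vars_sum)
  then have "indep_var (count_space UNIV) ((\<lambda>x. nat \<lfloor>x\<rfloor>) \<circ> (\<lambda>\<omega>. real (X i \<omega>)))
      (count_space UNIV) ((\<lambda>x. nat \<lfloor>x\<rfloor>) \<circ> (\<lambda>\<omega>. \<Sum>j\<in>I. real (X j \<omega>)))"
    by (rule indep_var_compose) measurable
  then show ?thesis
    by (simp add: comp_def flip: of_nat_sum)
qed

lemma (in prob_space) pgf_sum_indep:
  fixes X :: "'i \<Rightarrow> 'a \<Rightarrow> nat"
  assumes "finite I" "indep_vars (\<lambda>_. count_space UNIV) X I"
  shows "pgf M (\<lambda>\<omega>. \<Sum>i\<in>I. X i \<omega>) = (\<Prod>i\<in>I. pgf M (X i))"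
  using assms
proof (induction I rule: finite_induct)
  case empty
  show ?case
    by (rule fps_ext) (simp add: pgf_def prob_space)
next
  case (insert i I)
  have "indep_vars (\<lambda>_. count_space UNIV) X I"
    using insert.prems by (rule indep_vars_subset) auto
  then show ?case
    using insert pgf_add_indep [OF indep_var_sum_nat [OF insert.hyps insert.prems]] by simp
qed

lemma pgf_deg_zt_Poisson:
  assumes "deg_zt_Poisson M lam \<alpha> X"
  shows "pgf M X = fps_const (1 / (deg_exp lam 1 \<alpha> - 1)) *
    ((deg_exp_fps lam 1 - 1) oo (fps_const \<alpha> * fps_X))"
proof (rule fps_ext)
  fix n
  show "fps_nth (pgf M X) n = fps_nth (fps_const (1 / (deg_exp lam 1 \<alpha> - 1)) *
      ((deg_exp_fps lam 1 - 1) oo (fps_const \<alpha> * fps_X))) n"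
  proof (cases "n = 0")
    case True
    have "{\<omega> \<in> space M. X \<omega> = 0} = {}"
      using assms by (force simp: deg_zt_Poisson_def)
    then have "measure M {\<omega> \<in> space M. X \<omega> = 0} = 0"
      by (simp only: measure_empty)
    then show ?thesis
      using True by (simp add: pgf_def deg_exp_fps_def deg_ffact_def)
  next
    case False
    then show ?thesis
      using assms by (simp add: pgf_def deg_zt_Poisson_def deg_ztp_mass_def deg_exp_fps_def
          fps_compose_linear)
  qed
qed

theorem theorem2p5:
  fixes M :: "'a measure" and X :: "nat \<Rightarrow> 'a \<Rightarrow> nat"
    and lam \<alpha> :: real and k n :: nat
  assumes "prob_space M"
    and "\<alpha> > 0" and "k \<ge> 1"
    and "prob_space.indep_vars M (\<lambda>_. count_space UNIV) X {1..k}"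
    and "\<And>i. i \<in> {1..k} \<Longrightarrow> deg_zt_Poisson M lam \<alpha> (X i)"
  shows "measure M {\<omega> \<in> space M. (\<Sum>i=1..k. X i \<omega>) = n} =
    (if n \<ge> k
     then fact k / (deg_exp lam 1 \<alpha> - 1) ^ k * (\<alpha> ^ n / fact n) * deg_Stirling2 lam n k
     else 0)"
proof -
  interpret prob_space M by fact
  define c where "c = 1 / (deg_exp lam 1 \<alpha> - 1)"
  define G where "G = deg_exp_fps lam 1 - 1"
  have "pgf M (\<lambda>\<omega>. \<Sum>i=1..k. X i \<omega>) = (\<Prod>i=1..k. pgf M (X i))"
    using assms(4) by (intro pgf_sum_indep) auto
  also have "\<dots> = (\<Prod>i=1..k. fps_const c * (G oo (fps_const \<alpha> * fps_X)))"
    using assms(5) by (intro prod.cong) (auto simp: c_def G_def pgf_deg_zt_Poisson)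
  also have "\<dots> = fps_const (c ^ k) * ((G ^ k) oo (fps_const \<alpha> * fps_X))"
    by (simp add: power_mult_distrib fps_const_power fps_compose_power)
  finally have "fps_nth (pgf M (\<lambda>\<omega>. \<Sum>i=1..k. X i \<omega>)) n = c ^ k * (\<alpha> ^ n * fps_nth (G ^ k) n)"
    by (simp add: fps_compose_linear)
  then have "measure M {\<omega> \<in> space M. (\<Sum>i=1..k. X i \<omega>) = n} =
      fact k / (deg_exp lam 1 \<alpha> - 1) ^ k * (\<alpha> ^ n / fact n) * deg_Stirling2 lam n k"
    by (simp add: pgf_def c_def G_def deg_Stirling2_def power_divide)
  then show ?thesis
    by (simp add: deg_Stirling2_eq_0)
qed

end
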